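(* For every finite simple graph $G$, $\Delta(G)\leq M(G)\leq \Delta^+(G)$.
   Context: Graphs are finite and simple. For a real symmetric $n\times n$ matrix $A=[a_{ij}]$, the graph of $A$ is the simple graph on vertices $1,\ldots,n$ where $\{i,j\}$ ($i\neq j$) is an edge if and only if $a_{ij}\neq 0$ (the diagonal entries are unrestricted). For a graph $G$ on $n$ vertices, $S(G)$ is the set of all $n\times n$ real symmetric matrices whose graph is $G$, and $M(G)$ is the maximum multiplicity of an eigenvalue of a matrix in $S(G)$; equivalently $M(G)=\max_{A\in S(G)}\operatorname{nullity}(A)$. Say that deletion of $q$ vertices from $G$ leaves $p$ vertex-disjoint paths if the remaining induced subgraph has exactly $p$ connected components, each of which is a path (a single vertex counts as a path). $\Delta(G)$ is the maximum of $p-q$, and $\Delta^+(G)$ is the minimum of $p+q$, over all ways of deleting $q$ vertices from $G$ leaving $p$ vertex-disjoint paths. *)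

theory Defs
  imports "Jordan_Normal_Form.Char_Poly" "Graph_Theory.Digraph_Component"
begin

(* A finite simple graph is a pair_graph: a finite, loop-free set of arcs
   (ordered pairs) that is symmetric, the edge {u,v} being represented by the
   two arcs (u,v) and (v,u). A graph on n vertices has vertex set {0..<n}, in
   accordance with the row and column indices of matrices. *)

definition graph_of_mat :: "real mat \<Rightarrow> nat pair_pre_digraph" where
  "graph_of_mat A = \<lparr> pverts = {0..<dim_row A},
     parcs = {(i, j). i < dim_row A \<and> j < dim_row A \<and> i \<noteq> j \<and> A $$ (i, j) \<noteq> 0} \<rparr>"

definition sym_mats :: "nat pair_pre_digraph \<Rightarrow> real mat set" where
  "sym_mats G = {A. square_mat A \<and> transpose_mat A = A \<and> graph_of_mat A = G}"

(* The order of mu as a root of the characteristic polynomial is the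
   multiplicity of the eigenvalue mu, and 0 if mu is not an eigenvalue. Letting
   mu range over all reals thus only matters for the graph without vertices,
   where M = 0, the nullity of the empty matrix. All eigenvalues of a real
   symmetric matrix are real. *)
definition max_multiplicity :: "nat pair_pre_digraph \<Rightarrow> nat" where
  "max_multiplicity G = Max {Polynomial.order \<mu> (char_poly A) | A \<mu>. A \<in> sym_mats G}"

definition is_path_graph :: "('a, 'b) pre_digraph \<Rightarrow> bool" where
  "is_path_graph H \<longleftrightarrow> (\<exists>xs. xs \<noteq> [] \<and> distinct xs \<and> verts H = set xs \<and>
     arcs_ends H = {(u, v). \<exists>i. Suc i < length xs \<and> {u, v} = {xs ! i, xs ! Suc i}})"

(* As all arcs of G come in opposite pairs, the strongly connected components
   are the connected components of the undirected graph. *)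
definition deletion_leaves_paths :: "'a pair_pre_digraph \<Rightarrow> 'a set \<Rightarrow> nat \<Rightarrow> bool" where
  "deletion_leaves_paths G X p \<longleftrightarrow> X \<subseteq> pverts G \<and>
     (let \<C> = pre_digraph.sccs (with_proj G \<restriction> (pverts G - X))
      in card \<C> = p \<and> (\<forall>H \<in> \<C>. is_path_graph H))"

(* p - q can be negative for all admissible deletions, e.g. for large complete
   graphs. *)
definition Delta :: "'a pair_pre_digraph \<Rightarrow> int" where
  "Delta G = Max {int p - int (card X) | p X. deletion_leaves_paths G X p}"

definition Delta_plus :: "'a pair_pre_digraph \<Rightarrow> nat" where
  "Delta_plus G = Min {p + card X | p X. deletion_leaves_paths G X p}"

end

theory Submission
  imports Defs
    "Jordan_Normal_Form.Jordan_Normal_Form_Existence"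
    "Jordan_Normal_Form.Jordan_Normal_Form_Uniqueness"
    "Jordan_Normal_Form.DL_Rank"
begin

text \<open>
  For a real symmetric matrix \<open>A\<close> the multiplicity of an eigenvalue \<open>\<mu>\<close> is the dimension of
  the kernel of \<open>A - \<mu>I\<close> (\<open>order_char_poly_real_symmetric\<close>), so both inequalities are bounds on
  nullities. All kernels are taken over \<open>\<complex>\<close>, where Jordan normal forms exist. Let \<open>X\<close> be a set
  of \<open>q\<close> vertices whose deletion leaves \<open>p\<close> disjoint paths.
  
  Upper bound (\<open>multiplicity_le_paths_plus_deleted\<close>). Let \<open>A\<close> be any matrix of the graph, and let
  \<open>v\<close> be in the kernel of \<open>A - \<mu>I\<close> with \<open>v = 0\<close> on \<open>X\<close> and at one end of each path. On a
  path, the equation at a vertex involves, outside \<open>X\<close>, only this vertex, its predecessor and its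
  successor; if \<open>v\<close> vanishes at the first two, it vanishes at the successor as well. So zeros
  spread along the paths (\<open>kernel_vanishes_along_path\<close>) and \<open>v = 0\<close>. A subspace on which \<open>p + q\<close>
  coordinates determine the vector has dimension at most \<open>p + q\<close>
  (\<open>kernel_dim_le_card_determining_set\<close>).
  
  Lower bound (\<open>exists_multiplicity_ge_components_minus_deleted\<close>). One matrix with an eigenvalue of
  multiplicity at least \<open>p - q\<close> suffices. Take \<open>-1\<close> at every edge, and as diagonal entry the
  number of neighbours outside \<open>X\<close>; outside \<open>X\<close> this is the Laplacian of the remaining graph.
  Vectors that are constant on the remaining components and zero on \<open>X\<close> form a space of dimension
  \<open>p\<close>, and such a vector satisfies the kernel equation at every vertex outside \<open>X\<close>. Only the
  \<open>q\<close> equations at the vertices in \<open>X\<close> remain, so the nullity is at least \<open>p - q\<close>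
  (\<open>dim_le_kernel_dim_plus_equations\<close>).
\<close>

section \<open>Dimension bounds for kernels\<close>

text \<open>
  Padding the equations with zero rows gives a square matrix with a zero row, hence with determinant
  0. This is the only source of nontrivial vectors in the dimension counts below.
\<close>

lemma homogeneous_system_nontrivial_solution:
  fixes R :: "'a :: field vec set"
  assumes "finite R" "R \<subseteq> carrier_vec k" "card R < k"
  obtains v where "v \<in> carrier_vec k" "v \<noteq> 0\<^sub>v k" "\<And>r. r \<in> R \<Longrightarrow> r \<bullet> v = 0"
proof -
  obtain rs where rs: "set rs = R" "length rs = card R"
    using assms(1) by (metis finite_distinct_list distinct_card)
  define N where "N = mat_of_rows k (rs @ replicate (k - card R) (0\<^sub>v k))"
  have N: "N \<in> carrier_mat k k"
    using rs assms(3) by (auto simp: N_def)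
  have row: "row N i = (if i < card R then rs ! i else 0\<^sub>v k)" if "i < k" for i
    using that rs assms(2) unfolding N_def
    by (subst mat_of_rows_row) (auto simp: nth_append)
  have "transpose_mat N *\<^sub>v unit_vec k (k - 1) = 0\<^sub>v k"
  proof (rule eq_vecI)
    fix i assume i: "i < dim_vec (0\<^sub>v k :: 'a vec)"
    have "(transpose_mat N *\<^sub>v unit_vec k (k - 1)) $ i = row N (k - 1) $ i"
      using N i assms(3) by simp
    also have "\<dots> = 0"
      using row[of "k - 1"] assms(3) i by auto
    finally show "(transpose_mat N *\<^sub>v unit_vec k (k - 1)) $ i = 0\<^sub>v k $ i"
      using i by simp
  qed (use N in auto)
  moreover have "unit_vec k (k - 1) \<noteq> (0\<^sub>v k :: 'a vec)"
  proof
    assume "unit_vec k (k - 1) = (0\<^sub>v k :: 'a vec)"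
    hence "unit_vec k (k - 1) $ (k - 1) = (0\<^sub>v k :: 'a vec) $ (k - 1)" by simp
    thus False using assms(3) by simp
  qed
  ultimately have "\<exists>u. u \<in> carrier_vec k \<and> u \<noteq> 0\<^sub>v k \<and> transpose_mat N *\<^sub>v u = 0\<^sub>v k"
    by (intro exI[of _ "unit_vec k (k - 1)"]) simp
  hence "det (transpose_mat N) = 0"
    using N det_0_iff_vec_prod_zero_field[of "transpose_mat N" k] by simp
  hence "det N = 0"
    using det_transpose[OF N] by simp
  then obtain v where v: "v \<in> carrier_vec k" "v \<noteq> 0\<^sub>v k" "N *\<^sub>v v = 0\<^sub>v k"
    using det_0_iff_vec_prod_zero_field[OF N] by auto
  have "r \<bullet> v = 0" if "r \<in> R" for r
  proof -
    have "r \<in> set rs" using that rs(1) by simp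
    then obtain i where i: "i < card R" "r = rs ! i"
      using rs(2) by (auto simp: in_set_conv_nth)
    have "(N *\<^sub>v v) $ i = row N i \<bullet> v"
      using i N assms(3) by simp
    thus ?thesis
      using i v(3) row[of i] assms(3) by simp
  qed
  thus thesis by (rule that[OF v(1,2)])
qed

text \<open>
  A basis of the kernel, written as the columns of a matrix, turns questions about the dimension of
  the kernel into questions about linear systems in \<open>kernel_dim M\<close> unknowns.
\<close>

lemma kernel_basis_matrix:
  fixes M :: "'a :: field mat"
  assumes M: "M \<in> carrier_mat nr nc"
  obtains C where "C \<in> carrier_mat nc (kernel_dim M)"
    "mat_kernel M = (\<lambda>e. C *\<^sub>v e) ` carrier_vec (kernel_dim M)"
    "\<forall>e \<in> carrier_vec (kernel_dim M). C *\<^sub>v e = 0\<^sub>v nc \<longrightarrow> e = 0\<^sub>v (kernel_dim M)"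
proof -
  interpret kernel nr nc M by unfold_locales (rule M)
  obtain B where B: "finite B" "basis B"
    using kernel_basis_exists[OF M] by blast
  have dimB: "kernel_dim M = card B"
    using Ker.dim_basis[OF B] by simp
  have BK: "B \<subseteq> mat_kernel M" and indpt: "\<not> Ker.lin_dep B" and gen: "Ker.span B = mat_kernel M"
    using B(2) unfolding Ker.basis_def by auto
  have Bc: "B \<subseteq> carrier_vec nc"
    using BK mat_kernel_carrier[OF M] by auto
  obtain bs where bs: "set bs = B" "distinct bs" "length bs = card B"
    using B(1) by (metis finite_distinct_list distinct_card)
  define C where "C = mat_of_cols nc bs"
  have C: "C \<in> carrier_mat nc (card B)"
    using bs by (auto simp: C_def)
  have cols: "cols C = bs"
    unfolding C_def using Bc bs by (intro cols_mat_of_cols) auto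
  have 1: "e = 0\<^sub>v (card B)" if "e \<in> carrier_vec (card B)" "C *\<^sub>v e = 0\<^sub>v nc" for e
  proof (rule ccontr)
    assume "e \<noteq> 0\<^sub>v (card B)"
    hence "NC.lin_dep (set (cols C))"
      using NC.lin_depI[OF C that(1) _ that(2)] cols bs by auto
    thus False
      using indpt lindep_same[OF BK] cols bs by simp
  qed
  have 2: "\<exists>e \<in> carrier_vec (card B). v = C *\<^sub>v e" if "v \<in> mat_kernel M" for v
  proof -
    have "v \<in> NC.span B"
      using that gen span_same[OF BK] by simp
    then obtain a where "v = NC.lincomb a B"
      using NC.finite_span[OF B(1) Bc] by auto
    hence "v = C *\<^sub>v vec (card B) (\<lambda>i. a (col C i))"
      using NC.mat_mult_eq_lincomb[OF C, of a] cols bs by simp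
    thus ?thesis by auto
  qed
  have 3: "C *\<^sub>v e \<in> mat_kernel M" if "e \<in> carrier_vec (card B)" for e
  proof -
    have "C *\<^sub>v e = NC.lincomb (\<lambda>a. e $ find_first a bs) B"
      using NC.lincomb_eq_mat_mult[OF C that] cols bs by simp
    hence "C *\<^sub>v e \<in> NC.span B"
      using NC.finite_span[OF B(1) Bc] by auto
    thus ?thesis
      using gen span_same[OF BK] by simp
  qed
  show thesis
  proof (rule that[of C])
    show "C \<in> carrier_mat nc (kernel_dim M)" using C dimB by simp
    show "mat_kernel M = (\<lambda>e. C *\<^sub>v e) ` carrier_vec (kernel_dim M)"
      using 2 3 unfolding dimB by blast
    show "\<forall>e \<in> carrier_vec (kernel_dim M). C *\<^sub>v e = 0\<^sub>v nc \<longrightarrow> e = 0\<^sub>v (kernel_dim M)"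
      using 1 unfolding dimB by blast
  qed
qed

text \<open>
  If the kernel had a larger dimension than \<open>Z\<close> has elements, then requiring a combination of
  basis vectors to vanish on \<open>Z\<close> would be an underdetermined system.
\<close>

lemma kernel_dim_le_card_determining_set:
  fixes M :: "'a :: field mat"
  assumes M: "M \<in> carrier_mat nr nc" and Z: "Z \<subseteq> {..<nc}"
    and det: "\<And>v. v \<in> mat_kernel M \<Longrightarrow> (\<And>i. i \<in> Z \<Longrightarrow> v $ i = 0) \<Longrightarrow> v = 0\<^sub>v nc"
  shows "kernel_dim M \<le> card Z"
proof (rule ccontr)
  let ?d = "kernel_dim M"
  assume less: "\<not> ?d \<le> card Z"
  obtain C where C: "C \<in> carrier_mat nc ?d"
    and ker: "mat_kernel M = (\<lambda>e. C *\<^sub>v e) ` carrier_vec ?d"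
    and inj: "\<forall>e \<in> carrier_vec ?d. C *\<^sub>v e = 0\<^sub>v nc \<longrightarrow> e = 0\<^sub>v ?d"
    by (rule kernel_basis_matrix[OF M])
  have fin: "finite Z" using Z finite_subset by blast
  have "card (row C ` Z) < ?d"
    using less card_image_le[OF fin, of "row C"] by linarith
  moreover have "row C ` Z \<subseteq> carrier_vec ?d" "finite (row C ` Z)"
    using C fin by (auto intro!: carrier_vecI)
  ultimately obtain e where e: "e \<in> carrier_vec ?d" "e \<noteq> 0\<^sub>v ?d"
    and eZ: "\<And>r. r \<in> row C ` Z \<Longrightarrow> r \<bullet> e = 0"
    using homogeneous_system_nontrivial_solution by blast
  have "C *\<^sub>v e = 0\<^sub>v nc"
  proof (rule det)
    show "C *\<^sub>v e \<in> mat_kernel M" using ker e(1) by blast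
    fix i assume "i \<in> Z"
    thus "(C *\<^sub>v e) $ i = 0" using eZ[of "row C i"] Z C by auto
  qed
  thus False using inj e by blast
qed

lemma conjugate_mult_mat_vec:
  fixes C :: "'a :: conjugatable_ring mat"
  assumes "C \<in> carrier_mat n d" "e \<in> carrier_vec d"
  shows "conjugate (C *\<^sub>v e) = map_mat conjugate C *\<^sub>v conjugate e"
proof (rule eq_vecI)
  fix i assume "i < dim_vec (map_mat conjugate C *\<^sub>v conjugate e)"
  hence i: "i < n" using assms by simp
  have "row (map_mat conjugate C) i = conjugate (row C i)"
    using i assms by (intro eq_vecI) auto
  thus "conjugate (C *\<^sub>v e) $ i = (map_mat conjugate C *\<^sub>v conjugate e) $ i"
    using i assms by (simp add: conjugate_sprod_vec[of _ d])
qed (use assms in auto)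

text \<open>
  Suppose \<open>p > kernel_dim M + card Q\<close>. Ask that \<open>W c\<close> satisfies the equations in \<open>Q\<close>, so that
  it lies in the kernel of \<open>M\<close>, and also that it is orthogonal to a basis of that kernel. These are
  fewer than \<open>p\<close> equations, so a nonzero \<open>c\<close> solves them; but then \<open>W c\<close> is in the kernel and
  orthogonal to it, hence 0, although \<open>W\<close> is injective.
\<close>

lemma dim_le_kernel_dim_plus_equations:
  fixes M :: "'a :: conjugatable_ordered_field mat"
  assumes M: "M \<in> carrier_mat nr n" and W: "W \<in> carrier_mat n p"
    and inj: "\<And>c. c \<in> carrier_vec p \<Longrightarrow> W *\<^sub>v c = 0\<^sub>v n \<Longrightarrow> c = 0\<^sub>v p"
    and Q: "Q \<subseteq> {..<nr}"
    and other: "\<And>c i. c \<in> carrier_vec p \<Longrightarrow> i < nr \<Longrightarrow> i \<notin> Q \<Longrightarrow> (M *\<^sub>v (W *\<^sub>v c)) $ i = 0"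
  shows "p \<le> kernel_dim M + card Q"
proof (rule ccontr)
  let ?d = "kernel_dim M"
  assume less: "\<not> ?thesis"
  obtain C where C: "C \<in> carrier_mat n ?d"
    and ker: "mat_kernel M = (\<lambda>e. C *\<^sub>v e) ` carrier_vec ?d"
    using kernel_basis_matrix[OF M] by metis
  \<comment> \<open>\<open>D v = 0\<close> says that \<open>v\<close> is orthogonal to the kernel of \<open>M\<close>.\<close>
  define D where "D = transpose_mat (map_mat conjugate C)"
  have D: "D \<in> carrier_mat ?d n" using C by (simp add: D_def)
  have fin: "finite Q" using Q finite_subset by blast
  define R where "R = row (M * W) ` Q \<union> row (D * W) ` {..<?d}"
  have "card R \<le> card Q + ?d"
    unfolding R_def
    using card_Un_le[of "row (M * W) ` Q" "row (D * W) ` {..<?d}"]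
      card_image_le[OF fin, of "row (M * W)"] card_image_le[of "{..<?d}" "row (D * W)"] by simp
  hence "card R < p" using less by simp
  moreover have "R \<subseteq> carrier_vec p" "finite R"
    using fin W by (auto simp: R_def intro!: carrier_vecI)
  ultimately obtain c where c: "c \<in> carrier_vec p" "c \<noteq> 0\<^sub>v p" "\<And>r. r \<in> R \<Longrightarrow> r \<bullet> c = 0"
    using homogeneous_system_nontrivial_solution by blast
  define v where "v = W *\<^sub>v c"
  have v: "v \<in> carrier_vec n" unfolding v_def using W c(1) by (rule mult_mat_vec_carrier)
  have "M *\<^sub>v v = 0\<^sub>v nr"
  proof (rule eq_vecI)
    fix i assume "i < dim_vec (0\<^sub>v nr :: 'a vec)"
    hence i: "i < nr" by simp
    show "(M *\<^sub>v v) $ i = 0\<^sub>v nr $ i"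
    proof (cases "i \<in> Q")
      case True
      hence "row (M * W) i \<bullet> c = 0" using c(3) R_def by auto
      hence "((M * W) *\<^sub>v c) $ i = 0" using i M by simp
      thus ?thesis using i assoc_mult_mat_vec[OF M W c(1)] by (simp add: v_def)
    next
      case False
      thus ?thesis using other[OF c(1) i] i by (simp add: v_def)
    qed
  qed (use M in auto)
  hence "v \<in> mat_kernel M" using mat_kernelI[OF M v] by simp
  then obtain e where e: "e \<in> carrier_vec ?d" "v = C *\<^sub>v e" using ker by blast
  have "D *\<^sub>v v = 0\<^sub>v ?d"
  proof (rule eq_vecI)
    fix i assume "i < dim_vec (0\<^sub>v ?d :: 'a vec)"
    hence i: "i < ?d" by simp
    hence "row (D * W) i \<bullet> c = 0" using c(3) R_def by auto
    hence "((D * W) *\<^sub>v c) $ i = 0" using i D by simp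
    thus "(D *\<^sub>v v) $ i = 0\<^sub>v ?d $ i"
      using i assoc_mult_mat_vec[OF D W c(1)] by (simp add: v_def)
  qed (use D in auto)
  moreover have "v \<bullet>c v = (D *\<^sub>v v) \<bullet> conjugate e"
    unfolding D_def using transpose_vec_mult_scalar[of "map_mat conjugate C" n ?d "conjugate e" v] C e v
    by (simp add: conjugate_mult_mat_vec[OF C e(1)])
  ultimately have "v \<bullet>c v = 0" using e by simp
  hence "v = 0\<^sub>v n" using v by simp
  thus False using inj c by (auto simp: v_def)
qed

section \<open>Eigenvalue multiplicities of real symmetric matrices\<close>

text \<open>
  If \<open>H (H v) = 0\<close> then \<open>\<parallel>H v\<parallel>\<^sup>2 = \<langle>H (H v), v\<rangle> = 0\<close>, because \<open>H\<close> is Hermitian.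
\<close>

lemma mat_kernel_square_real_symmetric:
  fixes B :: "real mat"
  assumes B: "B \<in> carrier_mat n n" and sym: "transpose_mat B = B"
  defines "H \<equiv> map_mat complex_of_real B"
  shows "mat_kernel (H * H) = mat_kernel H"
proof
  have H: "H \<in> carrier_mat n n" using B by (simp add: H_def)
  have HT: "transpose_mat H = H"
    unfolding H_def using sym by (metis map_mat_transpose)
  have Hc: "map_mat conjugate H = H"
    by (auto simp: H_def intro!: eq_matI)
  show "mat_kernel (H * H) \<subseteq> mat_kernel H"
  proof
    fix v assume "v \<in> mat_kernel (H * H)"
    hence v: "v \<in> carrier_vec n" and "(H * H) *\<^sub>v v = 0\<^sub>v n"
      using H mat_kernelD[of "H * H" n n v] by auto
    hence HHv: "H *\<^sub>v (H *\<^sub>v v) = 0\<^sub>v n"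
      using assoc_mult_mat_vec[OF H H v] by simp
    have Hv: "H *\<^sub>v v \<in> carrier_vec n" using mult_mat_vec_carrier[OF H v] .
    have "(H *\<^sub>v v) \<bullet>c (H *\<^sub>v v) = (H *\<^sub>v v) \<bullet> (H *\<^sub>v conjugate v)"
      using conjugate_mult_mat_vec[OF H v] Hc by simp
    also have "\<dots> = (H *\<^sub>v (H *\<^sub>v v)) \<bullet> conjugate v"
      using transpose_vec_mult_scalar[of H n n "conjugate v" "H *\<^sub>v v"] H Hv v HT by simp
    also have "\<dots> = 0" using HHv v by simp
    finally have "H *\<^sub>v v = 0\<^sub>v n" using Hv by simp
    thus "v \<in> mat_kernel H" using mat_kernelI[OF H v] by simp
  qed
  show "mat_kernel H \<subseteq> mat_kernel (H * H)"
    using mat_kernel_mult_subset[OF H H] .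
qed

text \<open>
  In terms of the sizes \<open>ns\<close> of the Jordan blocks for an eigenvalue, the two sides of the hypothesis
  are the dimensions of the kernels of \<open>H\<^sup>2\<close> and \<open>H\<close>, and the conclusion says that all blocks
  have size at most 1.
\<close>

lemma sum_list_min_1_eq_if_min_2_eq:
  fixes ns :: "nat list"
  assumes "sum_list (map (min 2) ns) = sum_list (map (min 1) ns)"
  shows "sum_list (map (min 1) ns) = sum_list ns"
  using assms
proof (induction ns)
  case (Cons n ns)
  have "sum_list (map (min 1) ns) \<le> sum_list (map (min 2) ns)"
    by (intro sum_list_mono) auto
  moreover have "min 1 n \<le> min 2 n" by simp
  ultimately have "sum_list (map (min 2) ns) = sum_list (map (min 1) ns)" "min 2 n = min 1 n"
    using Cons.prems by auto
  thus ?case using Cons.IH by auto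
qed simp

text \<open>
  The order of \<open>\<mu>\<close> in the characteristic polynomial is the sum of the sizes of the Jordan blocks for
  \<open>\<mu>\<close>, and the kernel dimension is their number. The two agree because a block of size at least
  2 would enlarge the kernel on passing from \<open>A - \<mu>I\<close> to its square.
\<close>

lemma order_char_poly_real_symmetric:
  fixes A :: "real mat"
  assumes A: "A \<in> carrier_mat n n" and sym: "transpose_mat A = A"
  shows "Polynomial.order \<mu> (char_poly A) = kernel_dim (map_mat complex_of_real (char_matrix A \<mu>))"
proof -
  interpret P: map_poly_inj_idom_divide_hom complex_of_real ..
  let ?A = "map_mat complex_of_real A"
  define B where "B = char_matrix A \<mu>"
  define H where "H = map_mat complex_of_real B"
  have B: "B \<in> carrier_mat n n" using A by (simp add: B_def)
  have H: "H \<in> carrier_mat n n" using B by (simp add: H_def)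
  have symA: "A $$ (j, i) = A $$ (i, j)" if "i < n" "j < n" for i j
    using that A arg_cong[OF sym, of "\<lambda>A. A $$ (i, j)"] by simp
  have symB: "transpose_mat B = B"
    unfolding B_def char_matrix_def using A by (auto intro!: eq_matI simp: symA)
  have cA: "?A \<in> carrier_mat n n" using A by simp
  have charH: "char_matrix ?A (complex_of_real \<mu>) = H"
    unfolding H_def B_def char_matrix_def using A by (auto intro!: eq_matI)
  obtain es where "char_poly ?A = (\<Prod>e\<leftarrow>es. [:- e, 1:])"
    using char_poly_factorized[OF cA] by blast
  then obtain n_as where jnf: "jordan_nf ?A n_as"
    using jordan_nf_exists[OF cA] by blast
  define ns where "ns = map fst (filter (\<lambda>na. snd na = complex_of_real \<mu>) n_as)"
  have filt: "[(n, e)\<leftarrow>n_as . e = complex_of_real \<mu>] = filter (\<lambda>na. snd na = complex_of_real \<mu>) n_as"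
    by (rule filter_cong) auto
  have pow: "kernel_dim (H ^\<^sub>m k) = sum_list (map (min k) ns)" for k
    using dim_gen_eigenspace[OF jnf, of "complex_of_real \<mu>" k]
    unfolding dim_gen_eigenspace_def charH ns_def filt .
  have "kernel_dim (H * H) = kernel_dim H"
    using mat_kernel_square_real_symmetric[OF B symB] H unfolding kernel_dim_def H_def by simp
  moreover have "H ^\<^sub>m 2 = H * H" "H ^\<^sub>m 1 = H"
    using H by (auto simp: numeral_2_eq_2)
  ultimately have "sum_list (map (min 1) ns) = sum_list ns"
    using pow[of 1] pow[of 2] by (intro sum_list_min_1_eq_if_min_2_eq) simp
  hence "kernel_dim H = sum_list ns"
    using pow[of 1] \<open>H ^\<^sub>m 1 = H\<close> by simp
  also have "\<dots> = Polynomial.order (complex_of_real \<mu>) (char_poly ?A)"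
    unfolding jordan_nf_order[OF jnf] ns_def ..
  also have "\<dots> = Polynomial.order \<mu> (char_poly A)"
    by (simp add: of_real_hom.char_poly_hom[OF A] P.order_hom)
  finally show ?thesis unfolding H_def B_def ..
qed

section \<open>Zeros spreading along a path\<close>

text \<open>
  The equation in row \<open>xs ! i\<close>, with \<open>v\<close> known to vanish at \<open>xs ! i\<close> and \<open>xs ! (i - 1)\<close>,
  reduces to the single term of \<open>xs ! Suc i\<close>. The hypothesis \<open>nbr\<close> allows \<open>xs ! i\<close> to have
  neighbours off the path, provided that \<open>v\<close> vanishes there.
\<close>

lemma kernel_vanishes_along_path:
  fixes B :: "'a :: field mat"
  assumes B: "B \<in> carrier_mat nr n" and v: "v \<in> mat_kernel B"
    and xs: "set xs \<subseteq> {..<n}" "set xs \<subseteq> {..<nr}" "distinct xs"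
    and nbr: "\<And>i j. i < length xs \<Longrightarrow> j < n \<Longrightarrow> B $$ (xs ! i, j) \<noteq> 0 \<Longrightarrow> v $ j \<noteq> 0 \<Longrightarrow>
      j = xs ! i \<or> Suc i < length xs \<and> j = xs ! Suc i \<or> 0 < i \<and> j = xs ! (i - 1)"
    and edge: "\<And>i. Suc i < length xs \<Longrightarrow> B $$ (xs ! i, xs ! Suc i) \<noteq> 0"
    and start: "v $ (xs ! 0) = 0"
  shows "i < length xs \<Longrightarrow> v $ (xs ! i) = 0"
proof (induction i rule: less_induct)
  case (less k)
  show ?case
  proof (cases k)
    case 0
    thus ?thesis using start by simp
  next
    case (Suc i)
    have i: "i < length xs" "Suc i < length xs" using less.prems Suc by auto
    let ?y = "xs ! Suc i"
    have y: "?y < n" "xs ! i < nr" 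
      using subsetD[OF xs(1) nth_mem[OF i(2)]] subsetD[OF xs(2) nth_mem[OF i(1)]] by simp_all
    have zero: "B $$ (xs ! i, j) * v $ j = 0" if j: "j < n" "j \<noteq> ?y" for j
    proof (rule ccontr)
      assume nz: "B $$ (xs ! i, j) * v $ j \<noteq> 0"
      hence "j = xs ! i \<or> 0 < i \<and> j = xs ! (i - 1)"
        using nbr[OF i(1) j(1)] j(2) by auto
      thus False
        using less.IH[of i] less.IH[of "i - 1"] i Suc nz by (cases i) auto
    qed
    have vn: "dim_vec v = n" using mat_kernelD[OF B v] by simp
    have "(B *\<^sub>v v) $ (xs ! i) = 0"
      using mat_kernelD[OF B v] y by simp
    moreover have "(B *\<^sub>v v) $ (xs ! i) = (\<Sum>j = 0..<n. B $$ (xs ! i, j) * v $ j)"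
      using B y vn by (auto simp: scalar_prod_def intro!: sum.cong)
    moreover have "\<dots> = B $$ (xs ! i, ?y) * v $ ?y"
      using y zero by (subst sum.remove[of _ ?y]) (auto simp del: mult_eq_0_iff intro!: sum.neutral)
    ultimately show ?thesis using edge[OF i(2)] Suc by simp
  qed
qed

section \<open>Components left by a deletion\<close>

definition lists_path :: "'a pair_pre_digraph \<Rightarrow> 'a set \<Rightarrow> 'a list \<Rightarrow> bool" where
  "lists_path G T xs \<longleftrightarrow> xs \<noteq> [] \<and> distinct xs \<and> set xs = T \<and>
     (\<forall>u\<in>T. \<forall>v\<in>T. (u, v) \<in> parcs G \<longleftrightarrow>
        (\<exists>i. Suc i < length xs \<and> {u, v} = {xs ! i, xs ! Suc i}))"

text \<open>
  The strongly connected components of the remaining graph in elementary terms: a partition of the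
  remaining vertices without edges between different parts, each part being listed along a path.
  Symmetry of the arcs enters in that an edge joins vertices that reach each other.
\<close>

lemma components_after_deletion:
  assumes "pair_graph G" and del: "deletion_leaves_paths G X p"
  obtains \<S> where "finite \<S>" "card \<S> = p" "\<Union>\<S> = pverts G - X" "{} \<notin> \<S>"
    "\<forall>S \<in> \<S>. \<forall>T \<in> \<S>. S \<noteq> T \<longrightarrow> S \<inter> T = {}"
    "\<forall>T \<in> \<S>. \<forall>u \<in> T. \<forall>v \<in> pverts G - X. (u, v) \<in> parcs G \<longrightarrow> v \<in> T"
    "\<forall>T \<in> \<S>. \<exists>xs. lists_path G T xs"
proof -
  interpret G: pair_graph G by fact
  define K where "K = with_proj G \<restriction> (pverts G - X)"
  have ind: "induced_subgraph K (with_proj G)"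
    unfolding K_def by (rule G.induced_induce) auto
  interpret K: sym_digraph K
    using G.induced_graph_imp_graph[OF ind] .
  interpret K: fin_digraph K
    using G.pair_finite_verts G.pair_finite_arcs
    by unfold_locales (auto simp: K_def)
  have vK: "verts K = pverts G - X" by (simp add: K_def)
  have ends: "(u, v) \<in> arcs_ends (K \<restriction> T) \<longleftrightarrow> (u, v) \<in> parcs G \<and> u \<in> T \<and> v \<in> T"
    if "T \<subseteq> pverts G - X" for u v T
    using that by (force simp: arcs_ends_conv K_def)
  have endsK: "(u, v) \<in> arcs_ends K \<longleftrightarrow> (u, v) \<in> parcs G \<and> u \<in> pverts G - X \<and> v \<in> pverts G - X"
    for u v
    by (force simp: arcs_ends_conv K_def)
  have sub: "T \<subseteq> pverts G - X" if "T \<in> K.sccs_verts" for T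
    using K.sccs_verts_subsets[OF that] vK by simp
  have arcsym: "(v, u) \<in> parcs G" if "(u, v) \<in> parcs G" for u v
    using G.pair_sym_arcs that by (auto simp: symmetric_def dest: symD)
  have paths: "\<exists>xs. lists_path G T xs"
    if T: "T \<in> K.sccs_verts" for T
  proof -
    have "is_path_graph (K \<restriction> T)"
      using del T K.in_sccs_verts_conv
      unfolding deletion_leaves_paths_def K_def[symmetric] by (auto simp: Let_def)
    then obtain xs where xs: "xs \<noteq> []" "distinct xs" "T = set xs"
      "arcs_ends (K \<restriction> T) = {(u, v). \<exists>i. Suc i < length xs \<and> {u, v} = {xs ! i, xs ! Suc i}}"
      unfolding is_path_graph_def by auto
    have "(u, v) \<in> parcs G \<longleftrightarrow> (\<exists>i. Suc i < length xs \<and> {u, v} = {xs ! i, xs ! Suc i})"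
      if "u \<in> T" "v \<in> T" for u v
      using that ends[OF sub[OF T], of u v] xs(4) by auto
    with xs(1-3) show ?thesis unfolding lists_path_def by blast
  qed
  have closed: "v \<in> T" if "T \<in> K.sccs_verts" "u \<in> T" "v \<in> pverts G - X" "(u, v) \<in> parcs G" for T u v
  proof -
    have "u \<in> pverts G - X" using sub that by blast
    hence "u \<rightarrow>\<^bsub>K\<^esub> v" "v \<rightarrow>\<^bsub>K\<^esub> u" using that arcsym endsK by auto
    thus ?thesis
      using that unfolding K.sccs_verts_def by blast
  qed
  have union: "\<Union>K.sccs_verts = pverts G - X"
    using K.in_scc_of_self sub vK by (auto simp: K.sccs_verts_conv_scc_of)
  show thesis
  proof (rule that[of K.sccs_verts])
    show "card K.sccs_verts = p"
      using del K.card_sccs_verts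
      unfolding deletion_leaves_paths_def K_def[symmetric] by (simp add: Let_def)
    show "{} \<notin> K.sccs_verts" by (simp add: K.sccs_verts_def)
    show "finite K.sccs_verts" "\<Union>K.sccs_verts = pverts G - X"
      by (rule K.finite_sccs_verts, rule union)
    show "\<forall>S \<in> K.sccs_verts. \<forall>T \<in> K.sccs_verts. S \<noteq> T \<longrightarrow> S \<inter> T = {}"
      by (intro ballI impI K.sccs_verts_disjoint)
    show "\<forall>T \<in> K.sccs_verts. \<forall>u \<in> T. \<forall>v \<in> pverts G - X. (u, v) \<in> parcs G \<longrightarrow> v \<in> T"
    proof (intro ballI impI)
      fix T u v assume "T \<in> K.sccs_verts" "u \<in> T" "v \<in> pverts G - X" "(u, v) \<in> parcs G"
      thus "v \<in> T" by (rule closed)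
    qed
    show "\<forall>T \<in> K.sccs_verts. \<exists>xs. lists_path G T xs"
      by (intro ballI paths)
  qed
qed

section \<open>The two bounds\<close>

lemma sym_mats_iff:
  assumes "pair_graph G" "pverts G = {0..<n}"
  shows "A \<in> sym_mats G \<longleftrightarrow> A \<in> carrier_mat n n \<and> transpose_mat A = A \<and>
    (\<forall>i<n. \<forall>j<n. i \<noteq> j \<longrightarrow> A $$ (i, j) \<noteq> 0 \<longleftrightarrow> (i, j) \<in> parcs G)"
proof -
  interpret pair_graph G by fact
  have arcs: "i < n \<and> j < n \<and> i \<noteq> j" if "(i, j) \<in> parcs G" for i j
    using that wellformed' pair_no_loops assms(2) by fastforce
  have "graph_of_mat A = G \<longleftrightarrow> dim_row A = n \<and>
      {(i, j). i < n \<and> j < n \<and> i \<noteq> j \<and> A $$ (i, j) \<noteq> 0} = parcs G"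
    unfolding graph_of_mat_def using assms(2)
    by (cases G) (auto dest!: arg_cong[of "{0..<_}" "{0..<_}" card])
  also have "\<dots> \<longleftrightarrow> dim_row A = n \<and>
      (\<forall>i<n. \<forall>j<n. i \<noteq> j \<longrightarrow> A $$ (i, j) \<noteq> 0 \<longleftrightarrow> (i, j) \<in> parcs G)"
    using arcs by (simp add: set_eq_iff) blast
  finally show ?thesis
    unfolding sym_mats_def by auto
qed

text \<open>
  At a vertex of a remaining path, an edge leads to the deleted set or to another vertex of the same
  path, and there only to the two adjacent positions. This is what the spreading of zeros requires.
\<close>

lemma multiplicity_le_paths_plus_deleted:
  assumes G: "pair_graph G" "pverts G = {0..<n}"
    and del: "deletion_leaves_paths G X p" and A: "A \<in> sym_mats G"
  shows "Polynomial.order \<mu> (char_poly A) \<le> p + card X"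
proof -
  have Ac: "A \<in> carrier_mat n n" and sym: "transpose_mat A = A"
    and adj: "\<And>i j. i < n \<Longrightarrow> j < n \<Longrightarrow> i \<noteq> j \<Longrightarrow> A $$ (i, j) \<noteq> 0 \<longleftrightarrow> (i, j) \<in> parcs G"
    using A sym_mats_iff[OF G] by auto
  define B where "B = map_mat complex_of_real (char_matrix A \<mu>)"
  have B: "B \<in> carrier_mat n n" using Ac by (simp add: B_def)
  have Badj: "B $$ (i, j) \<noteq> 0 \<longleftrightarrow> (i, j) \<in> parcs G" if "i < n" "j < n" "i \<noteq> j" for i j
    using that Ac adj by (simp add: B_def char_matrix_def)
  have X: "X \<subseteq> {0..<n}" using del G(2) by (simp add: deletion_leaves_paths_def)
  hence finX: "finite X" using finite_subset by blast
  obtain \<S> where \<S>: "finite \<S>" "card \<S> = p" "\<Union>\<S> = pverts G - X"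
    and closed: "\<forall>T \<in> \<S>. \<forall>u \<in> T. \<forall>v \<in> pverts G - X. (u, v) \<in> parcs G \<longrightarrow> v \<in> T"
    and paths: "\<forall>T \<in> \<S>. \<exists>xs. lists_path G T xs"
    using components_after_deletion[OF G(1) del] by metis
  obtain path where path: "\<And>T. T \<in> \<S> \<Longrightarrow> lists_path G T (path T)"
    using paths by metis
  \<comment> \<open>The deleted vertices and one end of each path determine a kernel vector.\<close>
  define Z where "Z = X \<union> (\<lambda>T. path T ! 0) ` \<S>"
  have "Z \<subseteq> {..<n}"
  proof -
    have "path T ! 0 < n" if "T \<in> \<S>" for T
    proof -
      have "path T ! 0 \<in> T"
        using path[OF that] nth_mem[of 0 "path T"] by (auto simp: lists_path_def)
      thus ?thesis using that \<S>(3) G(2) by auto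
    qed
    thus ?thesis using X by (auto simp: Z_def)
  qed
  moreover have "v = 0\<^sub>v n" if v: "v \<in> mat_kernel B" and vZ: "\<And>i. i \<in> Z \<Longrightarrow> v $ i = 0" for v
  proof (rule eq_vecI)
    show "dim_vec v = dim_vec (0\<^sub>v n)" using mat_kernelD[OF B v] by simp
    fix k assume "k < dim_vec (0\<^sub>v n :: complex vec)"
    hence k: "k < n" by simp
    have "v $ k = 0"
    proof (cases "k \<in> X")
      case True
      thus ?thesis using vZ by (simp add: Z_def)
    next
      case False
      hence "k \<in> \<Union>\<S>" using \<S>(3) G(2) k by simp
      then obtain T where T: "T \<in> \<S>" "k \<in> T" by blast
      define xs where "xs = path T"
      have xs: "xs \<noteq> []" "distinct xs" "set xs = T"
        and arc: "\<And>u v. u \<in> T \<Longrightarrow> v \<in> T \<Longrightarrow> (u, v) \<in> parcs G \<longleftrightarrow>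
          (\<exists>i. Suc i < length xs \<and> {u, v} = {xs ! i, xs ! Suc i})"
        using path[OF T(1)] unfolding lists_path_def xs_def[symmetric] by auto
      have TV: "T \<subseteq> {..<n}" using T \<S>(3) G(2) by auto
      obtain i where i: "i < length xs" "xs ! i = k"
        using T xs by (metis in_set_conv_nth)
      have "v $ (xs ! i) = 0"
      proof (rule kernel_vanishes_along_path[OF B v _ _ xs(2) _ _ _ i(1)])
        show "set xs \<subseteq> {..<n}" "set xs \<subseteq> {..<n}" using xs TV by auto
        show "v $ (xs ! 0) = 0" using vZ T by (auto simp: Z_def xs_def)
        show "B $$ (xs ! m, xs ! Suc m) \<noteq> 0" if m: "Suc m < length xs" for m
        proof -
          have "xs ! m \<in> T" "xs ! Suc m \<in> T" "xs ! m \<noteq> xs ! Suc m"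
            using m xs by (auto simp: nth_eq_iff_index_eq)
          moreover from this have "(xs ! m, xs ! Suc m) \<in> parcs G"
            using arc m by blast
          ultimately show ?thesis using Badj TV by blast
        qed
        show "j = xs ! m \<or> Suc m < length xs \<and> j = xs ! Suc m \<or> 0 < m \<and> j = xs ! (m - 1)"
          if m: "m < length xs" and j: "j < n" and nz: "B $$ (xs ! m, j) \<noteq> 0" "v $ j \<noteq> 0" for m j
        proof (rule ccontr)
          assume contr: "\<not> ?thesis"
          have mT: "xs ! m \<in> T" using m xs by auto
          hence "(xs ! m, j) \<in> parcs G" using Badj[of "xs ! m" j] nz(1) contr TV j by auto
          moreover have "j \<in> pverts G - X" using nz(2) vZ j G(2) by (auto simp: Z_def)
          ultimately have "j \<in> T" using closed[rule_format, OF T(1) mT] by blast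
          then obtain l where l: "Suc l < length xs" "{xs ! m, j} = {xs ! l, xs ! Suc l}"
            using arc[OF mT] \<open>(xs ! m, j) \<in> parcs G\<close> by auto
          hence "xs ! m = xs ! l \<and> j = xs ! Suc l \<or> xs ! m = xs ! Suc l \<and> j = xs ! l"
            by (auto simp: doubleton_eq_iff)
          hence "m = l \<and> j = xs ! Suc l \<or> m = Suc l \<and> j = xs ! l"
            using l(1) m xs(2) by (auto simp: nth_eq_iff_index_eq)
          thus False using contr l(1) by auto
        qed
      qed
      thus ?thesis using i by simp
    qed
    thus "v $ k = 0\<^sub>v n $ k" using k by simp
  qed
  ultimately have "kernel_dim B \<le> card Z"
    using kernel_dim_le_card_determining_set[OF B] by blast
  also have "card Z \<le> card X + card \<S>"
    unfolding Z_def using card_Un_le card_image_le[OF \<S>(1)] by (meson add_left_mono order_trans)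
  finally show ?thesis
    using order_char_poly_real_symmetric[OF Ac sym, of \<mu>] \<S>(2) by (simp add: B_def)
qed

text \<open>
  The matrix \<open>A\<close> is a Laplacian outside \<open>X\<close>: its rows sum to 0 over the remaining vertices, so
  the indicator vectors of the components, the columns of \<open>W\<close>, satisfy all equations at remaining
  vertices. Since there are no edges between components, this holds for each component separately.
\<close>

lemma exists_multiplicity_ge_components_minus_deleted:
  assumes G: "pair_graph G" "pverts G = {0..<n}" and del: "deletion_leaves_paths G X p"
  obtains A where "A \<in> sym_mats G" "p \<le> Polynomial.order 0 (char_poly A) + card X"
proof -
  interpret pair_graph G by fact
  have arcsym: "(v, u) \<in> parcs G \<longleftrightarrow> (u, v) \<in> parcs G" for u v
    using pair_sym_arcs by (auto simp: symmetric_def dest: symD)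
  have noloop: "(u, u) \<notin> parcs G" for u
    using pair_no_loops by fastforce
  have X: "X \<subseteq> {0..<n}" using del G(2) by (simp add: deletion_leaves_paths_def)
  obtain \<S> where \<S>: "finite \<S>" "card \<S> = p" "\<Union>\<S> = pverts G - X" "{} \<notin> \<S>"
    and disj: "\<forall>S \<in> \<S>. \<forall>T \<in> \<S>. S \<noteq> T \<longrightarrow> S \<inter> T = {}"
    and closed: "\<forall>T \<in> \<S>. \<forall>u \<in> T. \<forall>v \<in> pverts G - X. (u, v) \<in> parcs G \<longrightarrow> v \<in> T"
    using components_after_deletion[OF G(1) del] by metis
  obtain Ts where Ts: "set Ts = \<S>" "distinct Ts" "length Ts = p"
    using \<S>(1,2) by (metis finite_distinct_list distinct_card)
  define U where "U = {0..<n} - X"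
  define A where "A = mat n n (\<lambda>(i, j). if i = j then real (card {k \<in> U. (i, k) \<in> parcs G})
    else if (i, j) \<in> parcs G then - 1 else 0)"
  have Ac: "A \<in> carrier_mat n n" by (simp add: A_def)
  have symA: "transpose_mat A = A"
    by (auto simp: A_def arcsym intro!: eq_matI)
  have AG: "A \<in> sym_mats G"
    unfolding sym_mats_iff[OF G] using Ac symA by (auto simp: A_def)
  define M where "M = map_mat complex_of_real (char_matrix A 0)"
  have M: "M \<in> carrier_mat n n" using Ac by (simp add: M_def)
  have Mij: "M $$ (i, j) = complex_of_real (A $$ (i, j))" if "i < n" "j < n" for i j
    using that Ac by (simp add: M_def char_matrix_def)
  have rowsum: "(\<Sum>j\<in>U. A $$ (i, j)) = 0" if i: "i \<in> U" for i
  proof -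
    have fin: "finite U" by (simp add: U_def)
    have "(\<Sum>j\<in>U. A $$ (i, j)) = A $$ (i, i) + (\<Sum>j\<in>U - {i}. A $$ (i, j))"
      using sum.remove[OF fin i] .
    also have "(\<Sum>j\<in>U - {i}. A $$ (i, j)) = (\<Sum>j\<in>U - {i}. if (i, j) \<in> parcs G then - 1 else 0)"
      using i by (intro sum.cong) (auto simp: A_def U_def)
    also have "\<dots> = - real (card {j \<in> U. (i, j) \<in> parcs G})"
    proof -
      have "(U - {i}) \<inter> {j. (i, j) \<in> parcs G} = {j \<in> U. (i, j) \<in> parcs G}"
        using noloop by auto
      thus ?thesis using fin by (simp add: sum.If_cases)
    qed
    finally show ?thesis using i by (simp add: A_def U_def)
  qed
  define W where "W = mat n p (\<lambda>(i, t). if i \<in> Ts ! t then 1 else 0 :: complex)"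
  have W: "W \<in> carrier_mat n p" by (simp add: W_def)
  have Wi: "(W *\<^sub>v c) $ i = (\<Sum>t = 0..<p. if i \<in> Ts ! t then c $ t else 0)"
    if "i < n" "c \<in> carrier_vec p" for c i
    using that by (auto simp: W_def scalar_prod_def intro!: sum.cong)
  have WT: "(W *\<^sub>v c) $ i = c $ t" if c: "c \<in> carrier_vec p" and t: "t < p" "i \<in> Ts ! t" for c i t
  proof -
    have "i < n" using t Ts \<S>(3) G(2) by (metis DiffD1 UnionI atLeastLessThan_iff nth_mem)
    moreover have "i \<in> Ts ! s \<longleftrightarrow> s = t" if "s < p" for s
      using disj[rule_format, of "Ts ! s" "Ts ! t"] that t Ts nth_eq_iff_index_eq[of Ts s t] by auto
    hence "(\<Sum>s = 0..<p. if i \<in> Ts ! s then c $ s else 0) = (\<Sum>s = 0..<p. if s = t then c $ s else 0)"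
      by (intro sum.cong) auto
    ultimately show ?thesis using Wi c t by (simp add: sum.delta)
  qed
  have WX: "(W *\<^sub>v c) $ i = 0" if "c \<in> carrier_vec p" "i \<in> X" for c i
  proof -
    have "i \<notin> Ts ! s" if "s < p" for s
      using \<open>i \<in> X\<close> that Ts \<S>(3) nth_mem[of s Ts] by blast
    thus ?thesis using Wi that X by auto
  qed
  have "p \<le> kernel_dim M + card X"
  proof (rule dim_le_kernel_dim_plus_equations[OF M W])
    show "X \<subseteq> {..<n}" using X by auto
    fix c :: "complex vec" assume c: "c \<in> carrier_vec p"
    {
      assume zero: "W *\<^sub>v c = 0\<^sub>v n"
      show "c = 0\<^sub>v p"
      proof (rule eq_vecI)
        fix t assume "t < dim_vec (0\<^sub>v p :: complex vec)"
        hence t: "t < p" by simp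
        hence "Ts ! t \<in> \<S>" using Ts by auto
        moreover from this have "Ts ! t \<noteq> {}" using \<S>(4) by metis
        ultimately obtain i where i: "i \<in> Ts ! t" "i \<in> \<Union>\<S>" by blast
        have "i < n" using i(2) \<S>(3) G(2) by simp
        thus "c $ t = 0\<^sub>v p $ t" using WT[OF c t i(1)] zero t by simp
      qed (use c in auto)
    }
    fix i assume i: "i < n" "i \<notin> X"
    hence iU: "i \<in> U" by (simp add: U_def)
    obtain t where t: "t < p" "i \<in> Ts ! t"
      using i \<S>(3) G(2) Ts by (metis DiffI UnionE atLeastLessThan_iff in_set_conv_nth zero_le)
    have "(M *\<^sub>v (W *\<^sub>v c)) $ i = (\<Sum>j = 0..<n. M $$ (i, j) * (W *\<^sub>v c) $ j)"
      using i M W by (auto simp: scalar_prod_def intro!: sum.cong)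
    also have "\<dots> = (\<Sum>j\<in>U. M $$ (i, j) * (W *\<^sub>v c) $ j)"
      using WX[OF c] by (intro sum.mono_neutral_right) (auto simp: U_def)
    also have "\<dots> = (\<Sum>j\<in>U. complex_of_real (A $$ (i, j)) * c $ t)"
    proof (rule sum.cong[OF refl])
      fix j assume j: "j \<in> U"
      show "M $$ (i, j) * (W *\<^sub>v c) $ j = complex_of_real (A $$ (i, j)) * c $ t"
      proof (cases "A $$ (i, j) = 0")
        case True
        thus ?thesis using Mij i j by (simp add: U_def)
      next
        case False
        hence "i = j \<or> (i, j) \<in> parcs G" using i j by (auto simp: A_def U_def split: if_splits)
        moreover have "Ts ! t \<in> \<S>" using t Ts by auto
        moreover have "j \<in> pverts G - X" using j G(2) by (simp add: U_def)
        ultimately have "j \<in> Ts ! t" using closed[rule_format, of "Ts ! t" i j] t(2) by blast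
        thus ?thesis using WT[OF c t(1)] Mij i j by (simp add: U_def)
      qed
    qed
    also have "\<dots> = complex_of_real (\<Sum>j\<in>U. A $$ (i, j)) * c $ t"
      by (simp add: sum_distrib_right)
    also have "\<dots> = 0" using rowsum[OF iU] by simp
    finally show "(M *\<^sub>v (W *\<^sub>v c)) $ i = 0" .
  qed
  thus thesis
    using that[OF AG] order_char_poly_real_symmetric[OF Ac symA, of 0] by (simp add: M_def)
qed

lemma order_char_poly_le_dim:
  fixes A :: "'a :: field mat"
  assumes "A \<in> carrier_mat n n"
  shows "Polynomial.order \<mu> (char_poly A) \<le> n"
proof -
  have "char_poly A \<noteq> 0"
    using degree_monic_char_poly[OF assms] by auto
  thus ?thesis
    using order_degree[of "char_poly A" \<mu>] degree_monic_char_poly[OF assms] by simp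
qed

section \<open>The extremal values\<close>

text \<open>
  This deletion shows that the sets of values that define \<open>Delta\<close> and \<open>Delta_plus\<close> are nonempty.
\<close>

lemma deletion_of_all_vertices: "deletion_leaves_paths G (pverts G) 0"
proof -
  have "pre_digraph.sccs (with_proj G \<restriction> {}) = {}"
    by (auto simp: pre_digraph.sccs_def strongly_connected_def induced_subgraph_def subgraph_def)
  thus ?thesis by (simp add: deletion_leaves_paths_def)
qed

text \<open>
  Since \<open>X\<close> determines \<open>p\<close>, there are at most as many values as sets of vertices.
\<close>

lemma deletion_values:
  "{f p X | p X. deletion_leaves_paths G X p} =
     (\<lambda>X. f (card (pre_digraph.sccs (with_proj G \<restriction> (pverts G - X)))) X) `
       {X. \<exists>p. deletion_leaves_paths G X p}"
  by (auto simp: deletion_leaves_paths_def Let_def)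

lemma finite_deletion_values:
  assumes "finite (pverts G)"
  shows "finite {f p X | p X. deletion_leaves_paths G X p}"
proof -
  have "{X. \<exists>p. deletion_leaves_paths G X p} \<subseteq> Pow (pverts G)"
    by (auto simp: deletion_leaves_paths_def)
  thus ?thesis
    unfolding deletion_values using assms finite_subset by blast
qed

theorem corollary2p8:
  fixes G :: "nat pair_pre_digraph" and n :: nat
  assumes "pair_graph G" and "pverts G = {0..<n}"
  shows "Delta G \<le> int (max_multiplicity G) \<and> max_multiplicity G \<le> Delta_plus G"
proof -
  define R where "R = {Polynomial.order \<mu> (char_poly A) | A \<mu>. A \<in> sym_mats G}"
  have M: "max_multiplicity G = Max R" by (simp add: max_multiplicity_def R_def)
  have fin: "finite (pverts G)" using assms(2) by simp
  have all: "deletion_leaves_paths G (pverts G) 0" by (rule deletion_of_all_vertices)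
  have "R \<subseteq> {..n}"
    using order_char_poly_le_dim sym_mats_iff[OF assms] by (auto simp: R_def)
  hence finR: "finite R" using finite_subset by blast
  have neR: "R \<noteq> {}"
  proof -
    obtain A where "A \<in> sym_mats G"
      using exists_multiplicity_ge_components_minus_deleted[OF assms all] by blast
    thus ?thesis by (auto simp: R_def)
  qed
  have "Delta G \<le> int (Max R)"
    unfolding Delta_def
  proof (rule Max.boundedI[OF finite_deletion_values[OF fin]])
    show "{int p - int (card X) |p X. deletion_leaves_paths G X p} \<noteq> {}" using all by blast
    fix d assume "d \<in> {int p - int (card X) |p X. deletion_leaves_paths G X p}"
    then obtain p X where d: "d = int p - int (card X)" "deletion_leaves_paths G X p" by blast
    obtain A where A: "A \<in> sym_mats G" "p \<le> Polynomial.order 0 (char_poly A) + card X"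
      using exists_multiplicity_ge_components_minus_deleted[OF assms d(2)] .
    have "Polynomial.order 0 (char_poly A) \<le> Max R"
      using A(1) finR by (intro Max_ge) (auto simp: R_def)
    thus "d \<le> int (Max R)" using A(2) d(1) by simp
  qed
  moreover have "Max R \<le> Delta_plus G"
    unfolding Delta_plus_def
  proof (rule Min.boundedI[OF finite_deletion_values[OF fin]])
    show "{p + card X |p X. deletion_leaves_paths G X p} \<noteq> {}" using all by blast
    fix d assume "d \<in> {p + card X |p X. deletion_leaves_paths G X p}"
    then obtain p X where d: "d = p + card X" "deletion_leaves_paths G X p" by blast
    show "Max R \<le> d"
      using multiplicity_le_paths_plus_deleted[OF assms d(2)] finR neR
      by (auto simp: d(1) R_def)
  qed
  ultimately show ?thesis by (simp add: M)
qed

end
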